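(* There is an absolute constant $c>0$ such that for every $n\ge 2$ and every $f\colon\{0,1\}^n\to\{0,1\}$ that depends on all $n$ variables, $\mathrm{rdeg}(f)\ge c\log n$ (that is, $\mathrm{rdeg}(f)\ge\Omega(\log n)$).
   Context: $f$ depends on variable $i$ if there is $x\in\{0,1\}^n$ with $f(x)\neq f(x^i)$, where $x^i$ is $x$ with the $i$th bit flipped. A rational representation of $f$ is a pair of multilinear $p,q\in\mathbb{R}[X_1,\dots,X_n]$ with $q(x)\neq 0$ and $p(x)/q(x)=f(x)$ for all $x\in\{0,1\}^n$; $\mathrm{rdeg}(f)$ is the minimum of $\max(\deg p,\deg q)$ over rational representations. *)

theory Defs
  imports Complex_Main "HOL-Library.FuncSet" "HOL-Library.Poly_Mapping"
begin

definition cube :: "nat \<Rightarrow> (nat \<Rightarrow> real) set" where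
  "cube n = {1..n} \<rightarrow>\<^sub>E {0, 1}"

definition flip :: "nat \<Rightarrow> (nat \<Rightarrow> real) \<Rightarrow> nat \<Rightarrow> real" where
  "flip i x = x(i := 1 - x i)"

definition depends_on :: "nat \<Rightarrow> ((nat \<Rightarrow> real) \<Rightarrow> real) \<Rightarrow> nat \<Rightarrow> bool" where
  "depends_on n f i \<longleftrightarrow> (\<exists>x\<in>cube n. f x \<noteq> f (flip i x))"

text \<open>Real polynomials: a monomial maps a variable index to its exponent, and a polynomial
  maps a monomial to its coefficient.\<close>
type_synonym real_mpoly = "(nat \<Rightarrow>\<^sub>0 nat) \<Rightarrow>\<^sub>0 real"

definition in_vars :: "nat \<Rightarrow> real_mpoly \<Rightarrow> bool" where
  "in_vars n p \<longleftrightarrow> (\<forall>m\<in>Poly_Mapping.keys p. Poly_Mapping.keys m \<subseteq> {1..n})"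

definition multilinear :: "real_mpoly \<Rightarrow> bool" where
  "multilinear p \<longleftrightarrow> (\<forall>m\<in>Poly_Mapping.keys p. \<forall>i. Poly_Mapping.lookup m i \<le> 1)"

definition mpoly_eval :: "real_mpoly \<Rightarrow> (nat \<Rightarrow> real) \<Rightarrow> real" where
  "mpoly_eval p x = (\<Sum>m\<in>Poly_Mapping.keys p. Poly_Mapping.lookup p m *
     (\<Prod>i\<in>Poly_Mapping.keys m. x i ^ Poly_Mapping.lookup m i))"

text \<open>Total degree, with the zero polynomial given degree 0. This convention does not
  affect \<open>rdeg\<close> below, since there the denominator is never the zero polynomial.\<close>
definition mpoly_degree :: "real_mpoly \<Rightarrow> nat" where
  "mpoly_degree p = Max (insert 0
     ((\<lambda>m. \<Sum>i\<in>Poly_Mapping.keys m. Poly_Mapping.lookup m i) ` Poly_Mapping.keys p))"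

definition rational_representation ::
    "nat \<Rightarrow> ((nat \<Rightarrow> real) \<Rightarrow> real) \<Rightarrow> real_mpoly \<Rightarrow> real_mpoly \<Rightarrow> bool" where
  "rational_representation n f p q \<longleftrightarrow>
     in_vars n p \<and> multilinear p \<and> in_vars n q \<and> multilinear q \<and>
     (\<forall>x\<in>cube n. mpoly_eval q x \<noteq> 0 \<and> mpoly_eval p x / mpoly_eval q x = f x)"

text \<open>The set is nonempty for every \<open>f\<close>: take the multilinear interpolant of \<open>f\<close> over 1.\<close>
definition rdeg :: "nat \<Rightarrow> ((nat \<Rightarrow> real) \<Rightarrow> real) \<Rightarrow> nat" where
  "rdeg n f = Inf {max (mpoly_degree p) (mpoly_degree q) | p q. rational_representation n f p q}"

end

theory Submission imports Defs begin

text \<open>Let \<open>f = p / q\<close> have degree \<open>d\<close>, and put \<open>P = p\<close>, \<open>Q = p - q\<close>, so that at every point of the cube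
  exactly one of \<open>P\<close>, \<open>Q\<close> vanishes. If \<open>f\<close> depends on \<open>i\<close>, then \<open>P(x) Q(x\<^sup>i)\<close> is a nonzero function of
  degree at most \<open>2d\<close> on the cube, hence \<open>i\<close> is sensitive at a fraction at least \<open>4\<^sup>-\<^sup>d\<close> of all points.
  It remains to bound the sensitivity at each point by \<open>2 ^ O(d)\<close>. At a point \<open>x\<close> where \<open>\<bar>Q\<bar>\<close> is maximal,
  every top monomial of \<open>P\<close> contains a block whose flip makes \<open>P\<close> nonzero and hence \<open>Q\<close> zero. A bounded
  function of degree \<open>d\<close> cannot drop from its maximum to zero on too many disjoint blocks, so a
  maximal disjoint family of top monomials of \<open>P\<close> is small. Fixing the variables in that family
  lowers the degree of \<open>P\<close>, and one repeats this \<open>d\<close> times.\<close>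

section \<open>Degree of functions on a cube\<close>

text \<open>Points of the cube are sets of coordinates; \<open>of_bool (M \<subseteq> X)\<close> is the multilinear monomial \<open>M\<close>.\<close>
definition deg_le :: "nat \<Rightarrow> ('a set \<Rightarrow> real) \<Rightarrow> bool" where
  "deg_le d F \<longleftrightarrow> (\<exists>A a. finite A \<and> (\<forall>M\<in>A. finite M \<and> card M \<le> d) \<and>
     (\<forall>X. F X = (\<Sum>M\<in>A. a M * of_bool (M \<subseteq> X))))"

lemma deg_leI:
  assumes "finite A" "\<And>M. M \<in> A \<Longrightarrow> finite M \<and> card M \<le> d"
    "\<And>X. F X = (\<Sum>M\<in>A. a M * of_bool (M \<subseteq> X))"
  shows "deg_le d F"
  using assms unfolding deg_le_def by blast

lemma deg_leE:
  assumes "deg_le d F"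
  obtains A a where "finite A" "\<And>M. M \<in> A \<Longrightarrow> finite M \<and> card M \<le> d"
    "\<And>M. M \<in> A \<Longrightarrow> a M \<noteq> 0"
    "\<And>X. F X = (\<Sum>M\<in>A. a M * of_bool (M \<subseteq> X))"
proof -
  obtain A a where A: "finite A" "\<forall>M\<in>A. finite M \<and> card M \<le> d"
    "\<forall>X. F X = (\<Sum>M\<in>A. a M * of_bool (M \<subseteq> X))"
    using assms unfolding deg_le_def by blast
  have "(\<Sum>M\<in>A. a M * of_bool (M \<subseteq> X)) = (\<Sum>M\<in>{M\<in>A. a M \<noteq> 0}. a M * of_bool (M \<subseteq> X))" for X
    using A(1) by (intro sum.mono_neutral_right) auto
  then have "F X = (\<Sum>M\<in>{M\<in>A. a M \<noteq> 0}. a M * of_bool (M \<subseteq> X))" for X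
    using A(3) by (simp only:)
  then show thesis using A(1,2) by (intro that[of "{M\<in>A. a M \<noteq> 0}" a]) (simp | blast)+
qed

lemma deg_le_monomial: "finite M \<Longrightarrow> card M \<le> d \<Longrightarrow> deg_le d (\<lambda>X. c * of_bool (M \<subseteq> X))"
  by (rule deg_leI[of "{M}" _ _ "\<lambda>_. c"]) auto

lemma deg_le_const: "deg_le d (\<lambda>X. c)"
  using deg_le_monomial[of "{}" d c] by simp

lemma deg_le_add:
  assumes "deg_le d F" "deg_le d G" shows "deg_le d (\<lambda>X. F X + G X)"
proof -
  obtain A a where A: "finite A" "\<And>M. M \<in> A \<Longrightarrow> finite M \<and> card M \<le> d"
    "\<And>X. F X = (\<Sum>M\<in>A. a M * of_bool (M \<subseteq> X))" using assms(1) by (rule deg_leE) blast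
  obtain B b where B: "finite B" "\<And>M. M \<in> B \<Longrightarrow> finite M \<and> card M \<le> d"
    "\<And>X. G X = (\<Sum>M\<in>B. b M * of_bool (M \<subseteq> X))" using assms(2) by (rule deg_leE) blast
  let ?c = "\<lambda>M. (if M \<in> A then a M else 0) + (if M \<in> B then b M else 0)"
  have "F X = (\<Sum>M\<in>A \<union> B. (if M \<in> A then a M else 0) * of_bool (M \<subseteq> X))" for X
    unfolding A(3) using A(1) B(1) by (intro sum.mono_neutral_cong_left) auto
  moreover have "G X = (\<Sum>M\<in>A \<union> B. (if M \<in> B then b M else 0) * of_bool (M \<subseteq> X))" for X
    unfolding B(3) using A(1) B(1) by (intro sum.mono_neutral_cong_left) auto
  ultimately show ?thesis
    using A(1,2) B(1,2)
    by (intro deg_leI[of "A \<union> B" _ _ ?c]) (auto simp: distrib_right sum.distrib)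
qed

lemma deg_le_sum:
  assumes "\<And>i. i \<in> I \<Longrightarrow> deg_le d (F i)" shows "deg_le d (\<lambda>X. \<Sum>i\<in>I. F i X)"
  using assms by (induction I rule: infinite_finite_induct) (simp_all add: deg_le_const deg_le_add)

text \<open>Coordinates are idempotent on the cube, so the product of the monomials \<open>M\<close>
  and \<open>N\<close> is the monomial \<open>M \<union> N\<close>, of size at most
  \<open>d + e\<close>.\<close>

lemma deg_le_mult:
  assumes "deg_le d F" "deg_le e G" shows "deg_le (d + e) (\<lambda>X. F X * G X)"
proof -
  obtain A a where A: "finite A" "\<And>M. M \<in> A \<Longrightarrow> finite M \<and> card M \<le> d"
    "\<And>X. F X = (\<Sum>M\<in>A. a M * of_bool (M \<subseteq> X))" using assms(1) by (rule deg_leE) blast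
  obtain B b where B: "finite B" "\<And>M. M \<in> B \<Longrightarrow> finite M \<and> card M \<le> e"
    "\<And>X. G X = (\<Sum>M\<in>B. b M * of_bool (M \<subseteq> X))" using assms(2) by (rule deg_leE) blast
  have "(\<lambda>X. F X * G X) = (\<lambda>X. \<Sum>M\<in>A. \<Sum>N\<in>B. (a M * b N) * of_bool (M \<union> N \<subseteq> X))"
    unfolding A(3) B(3) sum_product by (intro ext sum.cong refl) auto
  moreover have "card (M \<union> N) \<le> d + e" if "M \<in> A" "N \<in> B" for M N
    using A(2)[OF that(1)] B(2)[OF that(2)] card_Un_le[of M N] by linarith
  ultimately show ?thesis
    using A(2) B(2) by (simp only:) (intro deg_le_sum deg_le_monomial; simp)
qed

lemma deg_le_cmult: "deg_le d F \<Longrightarrow> deg_le d (\<lambda>X. c * F X)"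
  using deg_le_mult[OF deg_le_const[of 0 c]] by simp

lemma deg_le_diff: "deg_le d F \<Longrightarrow> deg_le d G \<Longrightarrow> deg_le d (\<lambda>X. F X - G X)"
  using deg_le_add[OF _ deg_le_cmult[of d G "-1"]] by simp

lemma deg_le_mono: "deg_le d F \<Longrightarrow> d \<le> e \<Longrightarrow> deg_le e F"
  by (erule deg_leE, rule deg_leI) (blast intro: order_trans)+

lemma deg_le_0:
  assumes "deg_le 0 F" shows "F X = F Y"
proof -
  obtain A a where A: "finite A" "\<And>M. M \<in> A \<Longrightarrow> finite M \<and> card M \<le> 0"
    "\<And>X. F X = (\<Sum>M\<in>A. a M * of_bool (M \<subseteq> X))" using assms by (rule deg_leE) blast
  then have "M = {}" if "M \<in> A" for M using that by (metis card_eq_0_iff le_zero_eq)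
  then show ?thesis unfolding A(3) by (intro sum.cong) auto
qed

lemma deg_le_prod:
  assumes "finite M" "\<And>j. j \<in> M \<Longrightarrow> deg_le 1 (F j)" shows "deg_le (card M) (\<lambda>X. \<Prod>j\<in>M. F j X)"
  using assms
proof (induction M)
  case (insert j M)
  then show ?case using deg_le_mult[of 1 "F j" "card M" "\<lambda>X. \<Prod>j\<in>M. F j X"] by simp
qed (auto intro: deg_le_const)

text \<open>A monomial \<open>M\<close> is the product of its coordinates, so replacing each
  coordinate by a function of degree at most 1 gives degree at most \<open>card M\<close>.
  Restrictions, flips and merging blocks into single variables are all substitutions of this
  kind.\<close>

lemma deg_le_compose:
  assumes "deg_le d F" "\<And>j. deg_le 1 (\<lambda>Y. of_bool (j \<in> \<phi> Y))"
  shows "deg_le d (\<lambda>Y. F (\<phi> Y))"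
proof -
  obtain A a where A: "finite A" "\<And>M. M \<in> A \<Longrightarrow> finite M \<and> card M \<le> d"
    "\<And>X. F X = (\<Sum>M\<in>A. a M * of_bool (M \<subseteq> X))" using assms(1) by (rule deg_leE) blast
  have pr: "of_bool (M \<subseteq> X) = (\<Prod>j\<in>M. of_bool (j \<in> X) :: real)" if "finite M" for M X
    using that by (induction M) auto
  have "deg_le d (\<lambda>Y. a M * of_bool (M \<subseteq> \<phi> Y))" if "M \<in> A" for M
  proof -
    have "deg_le (card M) (\<lambda>Y. \<Prod>j\<in>M. of_bool (j \<in> \<phi> Y))"
      using A(2)[OF that] assms(2) by (intro deg_le_prod) auto
    then show ?thesis
      using A(2)[OF that] by (simp only: pr) (intro deg_le_cmult; erule deg_le_mono; simp)
  qed
  then show ?thesis unfolding A(3) by (rule deg_le_sum)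
qed

lemma deg_le_member: "deg_le 1 (\<lambda>X. of_bool (j \<in> X))"
  using deg_le_monomial[of "{j}" 1 1] by simp

lemma deg_le_nonmember: "deg_le 1 (\<lambda>X. of_bool (j \<notin> X))"
  using deg_le_diff[OF deg_le_const[of 1 1] deg_le_member[of j]] by (simp add: of_bool_not_iff)

lemma deg_le_restrict:
  assumes "deg_le d F" shows "deg_le d (\<lambda>X. F (X - S \<union> R))"
proof (rule deg_le_compose[OF assms])
  fix j
  show "deg_le 1 (\<lambda>X. of_bool (j \<in> X - S \<union> R))"
    by (cases "j \<in> R"; cases "j \<in> S") (simp_all add: deg_le_const deg_le_member del: of_bool_eq_1_iff One_nat_def)
qed

section \<open>Bounded functions and disjoint blocks\<close>

text \<open>Adding \<open>M\<close> matches the subsets of \<open>Y - M\<close> with the subsets of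
  \<open>Y\<close> that contain \<open>M\<close>. Averaging a monomial over all subsets of
  \<open>Y\<close> thus multiplies it by \<open>1 / 2 ^ card M\<close>.\<close>

lemma sum_supersets_Pow:
  assumes "finite Y" "finite M"
  shows "(\<Sum>Z\<in>Pow Y. of_bool (M \<subseteq> Z)) = (of_bool (M \<subseteq> Y) * 2 ^ card Y / 2 ^ card M :: real)"
proof (cases "M \<subseteq> Y")
  case True
  have eq: "Pow Y \<inter> {Z. M \<subseteq> Z} = (\<union>) M ` Pow (Y - M)"
  proof
    show "Pow Y \<inter> {Z. M \<subseteq> Z} \<subseteq> (\<union>) M ` Pow (Y - M)"
    proof
      fix Z assume "Z \<in> Pow Y \<inter> {Z. M \<subseteq> Z}"
      then have "Z = M \<union> (Z - M)" "Z - M \<in> Pow (Y - M)" by auto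
      then show "Z \<in> (\<union>) M ` Pow (Y - M)" by (rule image_eqI)
    qed
  qed (use True in auto)
  have "(\<Sum>Z\<in>Pow Y. of_bool (M \<subseteq> Z) :: real) = real (card (Pow Y \<inter> {Z. M \<subseteq> Z}))"
    using assms(1) by simp
  also have "card (Pow Y \<inter> {Z. M \<subseteq> Z}) = card (Pow (Y - M))"
    unfolding eq by (rule card_image) (auto simp: inj_on_def)
  also have "real \<dots> = 2 ^ (card Y - card M)"
    using assms True by (simp add: card_Pow card_Diff_subset)
  also have "\<dots> = 2 ^ card Y / 2 ^ card M"
    using card_mono[OF assms(1) True] by (simp add: power_diff)
  finally show ?thesis using True by simp
next
  case False
  then have "(\<Sum>Z\<in>Pow Y. of_bool (M \<subseteq> Z) :: real) = 0"
    by (intro sum.neutral) auto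
  with False show ?thesis by simp
qed

text \<open>An affine function has additive increments. This is the base case of the bound
  below.\<close>

lemma deg_le_1_sum_singletons:
  assumes "deg_le 1 g" "finite K"
  shows "(\<Sum>i\<in>K. g {i} - g {}) = g K - g {}"
proof -
  obtain A a where A: "finite A" "\<And>M. M \<in> A \<Longrightarrow> finite M \<and> card M \<le> 1"
    "\<And>X. g X = (\<Sum>M\<in>A. a M * of_bool (M \<subseteq> X))" using assms(1) by (rule deg_leE) blast
  have single: "(\<Sum>i\<in>K. of_bool (M \<subseteq> {i}) - of_bool (M \<subseteq> {})) = (of_bool (M \<subseteq> K) - of_bool (M \<subseteq> {}) :: real)"
    if M: "M \<in> A" for M
  proof (cases "M = {}")
    case False
    then obtain j where "M = {j}"
      using A(2)[OF M] by (metis One_nat_def card_1_singletonE card_gt_0_iff le_antisym Suc_leI)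
    then show ?thesis using assms(2) by (simp add: of_bool_def)
  qed simp
  have "(\<Sum>i\<in>K. g {i} - g {}) = (\<Sum>i\<in>K. \<Sum>M\<in>A. a M * (of_bool (M \<subseteq> {i}) - of_bool (M \<subseteq> {})))"
    unfolding A(3) right_diff_distrib sum_subtractf ..
  also have "\<dots> = (\<Sum>M\<in>A. a M * (\<Sum>i\<in>K. of_bool (M \<subseteq> {i}) - of_bool (M \<subseteq> {})))"
    unfolding sum_distrib_left by (rule sum.swap)
  also have "\<dots> = (\<Sum>M\<in>A. a M * (of_bool (M \<subseteq> K) - of_bool (M \<subseteq> {})))"
    by (intro sum.cong refl) (simp only: single)
  also have "\<dots> = g K - g {}"
    unfolding A(3) right_diff_distrib sum_subtractf ..
  finally show ?thesis .
qed

text \<open>A substitute for Markov's inequality at an endpoint. Averaging \<open>g\<close> over the subsets of its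
  argument scales degree \<open>k\<close> monomials by \<open>2 ^ -k\<close>, so a combination with \<open>g\<close> itself cancels the
  top degree while keeping the linear part and a bound.\<close>
lemma deg_le_sum_singletons_bound:
  assumes "deg_le d g" "\<And>Y. finite Y \<Longrightarrow> \<bar>g Y\<bar> \<le> c" "finite K"
  shows "\<bar>\<Sum>i\<in>K. g {i} - g {}\<bar> \<le> 2 * c * 5 ^ d"
  using assms(1,2)
proof (induction d arbitrary: g c)
  case 0
  have "g {i} - g {} = 0" for i using deg_le_0[OF 0(1)] by simp
  moreover have "c \<ge> 0" using 0(2)[of "{}"] by simp
  ultimately show ?case by simp
next
  case (Suc d)
  have c: "c \<ge> 0" using Suc.prems(2)[of "{}"] by simp
  show ?case
  \<comment> \<open>The degree here is \<open>Suc d\<close>. For degree 1 the scaling factor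
    \<open>2 ^ d - 1\<close> used below vanishes, so affine functions are treated directly.\<close>
  proof (cases "d = 0")
    case True
    then have "(\<Sum>i\<in>K. g {i} - g {}) = g K - g {}"
      using Suc.prems(1) assms(3) deg_le_1_sum_singletons by auto
    then show ?thesis using Suc.prems(2)[of K] Suc.prems(2)[of "{}"] assms(3) c True by simp
  next
    case False
    obtain A a where A: "finite A" "\<And>M. M \<in> A \<Longrightarrow> finite M \<and> card M \<le> Suc d"
      "\<And>X. g X = (\<Sum>M\<in>A. a M * of_bool (M \<subseteq> X))" using Suc.prems(1) by (rule deg_leE) blast
    \<comment> \<open>On finite \<open>Y\<close> this is \<open>2 ^ Suc d\<close> times the average
      of \<open>g\<close> over subsets of \<open>Y\<close>, minus \<open>g Y\<close>. Written by
      coefficients, it shows that monomials of size \<open>Suc d\<close> disappear.\<close>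
    define h where "h Y = (\<Sum>M\<in>A. (a M * (2 ^ (Suc d - card M) - 1)) * of_bool (M \<subseteq> Y))" for Y
    have "deg_le d (\<lambda>Y. (a M * (2 ^ (Suc d - card M) - 1)) * of_bool (M \<subseteq> Y))" if "M \<in> A" for M
    proof (cases "card M = Suc d")
      case True
      then show ?thesis by (simp add: deg_le_const)
    next
      case False
      then show ?thesis using A(2)[OF that] by (intro deg_le_monomial) auto
    qed
    then have deg: "deg_le d h" unfolding h_def by (rule deg_le_sum)
    have h: "h Y = 2 ^ Suc d * ((\<Sum>Z\<in>Pow Y. g Z) / 2 ^ card Y) - g Y" if "finite Y" for Y
    proof -
      have "(\<Sum>Z\<in>Pow Y. g Z) = (\<Sum>M\<in>A. a M * (\<Sum>Z\<in>Pow Y. of_bool (M \<subseteq> Z)))"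
        unfolding A(3) sum_distrib_left by (rule sum.swap)
      also have "\<dots> = (\<Sum>M\<in>A. a M * (of_bool (M \<subseteq> Y) * 2 ^ card Y / 2 ^ card M))"
        using A(2) sum_supersets_Pow[OF that] by (intro sum.cong refl arg_cong2[where f="(*)"]) auto
      finally have "2 ^ Suc d * ((\<Sum>Z\<in>Pow Y. g Z) / 2 ^ card Y) - g Y =
        (\<Sum>M\<in>A. 2 ^ Suc d * (a M * (of_bool (M \<subseteq> Y) * 2 ^ card Y / 2 ^ card M) / 2 ^ card Y)
            - a M * of_bool (M \<subseteq> Y))"
        by (simp only: A(3)[of Y] sum_divide_distrib sum_distrib_left sum_subtractf)
      also have "\<dots> = h Y"
        unfolding h_def
      proof (intro sum.cong refl)
        fix M assume "M \<in> A"
        then have "(2::real) ^ (Suc d - card M) = 2 ^ Suc d / 2 ^ card M"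
          using A(2) by (simp only: power_diff[of "2::real"]) 
        then show "2 ^ Suc d * (a M * (of_bool (M \<subseteq> Y) * 2 ^ card Y / 2 ^ card M) / 2 ^ card Y)
            - a M * of_bool (M \<subseteq> Y) = a M * (2 ^ (Suc d - card M) - 1) * of_bool (M \<subseteq> Y)"
          by (simp only:) (simp add: field_simps)
      qed
      finally show ?thesis ..
    qed
    have bound: "\<bar>h Y\<bar> \<le> (2 ^ Suc d + 1) * c" if Y: "finite Y" for Y
    proof -
      have "\<bar>\<Sum>Z\<in>Pow Y. g Z\<bar> \<le> (\<Sum>Z\<in>Pow Y. \<bar>g Z\<bar>)" by (rule sum_abs)
      also have "\<dots> \<le> (\<Sum>Z\<in>Pow Y. c)"
        using Y Suc.prems(2) by (intro sum_mono) (auto dest: finite_subset)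
      also have "\<dots> = 2 ^ card Y * c" using Y by (simp add: card_Pow)
      finally have "\<bar>(\<Sum>Z\<in>Pow Y. g Z) / 2 ^ card Y\<bar> \<le> c"
        by (simp add: abs_divide divide_le_eq mult.commute)
      then have "\<bar>2 ^ Suc d * ((\<Sum>Z\<in>Pow Y. g Z) / 2 ^ card Y)\<bar> \<le> 2 ^ Suc d * c"
        unfolding abs_mult by (intro mult_mono) auto
      moreover have "\<bar>g Y\<bar> \<le> c" using Suc.prems(2) Y .
      ultimately have "\<bar>2 ^ Suc d * ((\<Sum>Z\<in>Pow Y. g Z) / 2 ^ card Y) - g Y\<bar> \<le> 2 ^ Suc d * c + c"
        by linarith
      then show ?thesis unfolding h[OF Y] by (simp only: distrib_right mult_1)
    qed
    \<comment> \<open>Only the monomial \<open>{i}\<close> contributes to either increment, and its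
      coefficient is scaled by \<open>2 ^ d - 1\<close>.\<close>
    have lin: "h {i} - h {} = (2 ^ d - 1) * (g {i} - g {})" for i
    proof -
      have "h {i} - h {} = (\<Sum>M\<in>A. a M * (2 ^ (Suc d - card M) - 1) * (of_bool (M \<subseteq> {i}) - of_bool (M \<subseteq> {})))"
        unfolding h_def right_diff_distrib sum_subtractf ..
      also have "\<dots> = (\<Sum>M\<in>A. (2 ^ d - 1) * (a M * (of_bool (M \<subseteq> {i}) - of_bool (M \<subseteq> {}))))"
      proof (intro sum.cong refl)
        fix M
        consider "M = {}" | "M = {i}" | "\<not> M \<subseteq> {i}" by blast
        then show "a M * (2 ^ (Suc d - card M) - 1) * (of_bool (M \<subseteq> {i}) - of_bool (M \<subseteq> {})) =
          (2 ^ d - 1) * (a M * (of_bool (M \<subseteq> {i}) - of_bool (M \<subseteq> {})))"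
          by cases auto
      qed
      also have "\<dots> = (2 ^ d - 1) * (g {i} - g {})"
        unfolding A(3) by (simp only: sum_subtractf[symmetric] sum_distrib_left right_diff_distrib)
      finally show ?thesis .
    qed
    let ?S = "\<Sum>i\<in>K. g {i} - g {}"
    have d2: "(2::real) ^ d \<ge> 2" using False self_le_power[of "2::real" d] by simp
    have "(2 ^ d - 1) * \<bar>?S\<bar> = \<bar>(2 ^ d - 1) * ?S\<bar>" using d2 by (simp add: abs_mult)
    also have "\<dots> = \<bar>\<Sum>i\<in>K. h {i} - h {}\<bar>" by (simp only: lin sum_distrib_left)
    also have "\<dots> \<le> 2 * ((2 ^ Suc d + 1) * c) * 5 ^ d"
      by (rule Suc.IH[OF deg bound])
    also have "\<dots> = (2 ^ Suc d + 1) * (2 * c * 5 ^ d)" by simp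
    \<comment> \<open>The base 5 comes from here: \<open>2 ^ Suc d + 1\<close> is at most
      \<open>5 * (2 ^ d - 1)\<close> as soon as \<open>2 ^ d\<close> is at least 2, with equality at
      \<open>d = 1\<close>.\<close>
    also have "\<dots> \<le> (5 * (2 ^ d - 1)) * (2 * c * 5 ^ d)"
      using d2 c by (intro mult_right_mono) auto
    also have "\<dots> = (2 ^ d - 1) * (2 * c * 5 ^ Suc d)" by simp
    finally show ?thesis using d2 by (simp add: mult_le_cancel_left)
  qed
qed

text \<open>Each block becomes one variable, on which \<open>g\<close> switches the flip of that
  block on or off. All increments of \<open>g\<close> at the empty set equal \<open>- Q x\<close>,
  so they add up without cancellation, while the previous bound limits their sum to
  \<open>2 * 5 ^ d\<close> times the maximum of \<open>Q\<close> in absolute value.\<close>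

lemma card_disjoint_blocks_le:
  fixes Q :: "'a set \<Rightarrow> real"
  assumes "deg_le d Q" "\<And>X. \<bar>Q X\<bar> \<le> \<bar>Q x\<bar>" "Q x \<noteq> 0"
    and "finite \<B>" "pairwise disjnt \<B>" "\<And>B. B \<in> \<B> \<Longrightarrow> Q (sym_diff x B) = 0"
  shows "card \<B> \<le> 2 * 5 ^ d"
proof -
  define g where "g Y = Q (sym_diff x (\<Union>(Y \<inter> \<B>)))" for Y
  have "deg_le d g"
    unfolding g_def
  proof (rule deg_le_compose[OF assms(1)])
    fix j
    show "deg_le 1 (\<lambda>Y. of_bool (j \<in> sym_diff x (\<Union>(Y \<inter> \<B>))))"
    proof (cases "\<exists>B\<in>\<B>. j \<in> B")
      case True
      then obtain B where B: "B \<in> \<B>" "j \<in> B" by blast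
      \<comment> \<open>Disjointness keeps the degree at \<open>d\<close>: whether coordinate
        \<open>j\<close> is flipped is decided by a single block.\<close>
      have uniq: "B' = B" if "B' \<in> \<B>" "j \<in> B'" for B'
        using pairwiseD[OF assms(5) that(1) B(1)] that(2) B(2) by (auto simp: disjnt_iff)
      have "j \<in> \<Union>(Y \<inter> \<B>) \<longleftrightarrow> B \<in> Y" for Y
      proof
        assume "j \<in> \<Union>(Y \<inter> \<B>)"
        then obtain B' where "B' \<in> Y" "B' \<in> \<B>" "j \<in> B'" by auto
        with uniq[of B'] show "B \<in> Y" by simp
      qed (use B in auto)
      then have "j \<in> sym_diff x (\<Union>(Y \<inter> \<B>)) \<longleftrightarrow> (if j \<in> x then B \<notin> Y else B \<in> Y)" for Y
        by auto
      then show ?thesis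
        by (cases "j \<in> x") (simp_all only: if_True if_False deg_le_member deg_le_nonmember)
    next
      case False
      then have "j \<in> sym_diff x (\<Union>(Y \<inter> \<B>)) \<longleftrightarrow> j \<in> x" for Y by auto
      then show ?thesis by (simp only: deg_le_const)
    qed
  qed
  then have "\<bar>\<Sum>B\<in>\<B>. g {B} - g {}\<bar> \<le> 2 * \<bar>Q x\<bar> * 5 ^ d"
    by (rule deg_le_sum_singletons_bound) (auto simp: g_def assms(2,4))
  moreover have "(\<Sum>B\<in>\<B>. g {B} - g {}) = (\<Sum>B\<in>\<B>. - Q x)"
    by (intro sum.cong refl) (simp add: g_def assms(6))
  ultimately have "\<bar>Q x\<bar> * real (card \<B>) \<le> \<bar>Q x\<bar> * (2 * 5 ^ d)"
    by (simp add: abs_mult mult_ac)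
  then have "real (card \<B>) \<le> real (2 * 5 ^ d)" using assms(3) by simp
  then show ?thesis by (simp only: of_nat_le_iff)
qed

section \<open>Sensitivity and influence\<close>

text \<open>The terms for \<open>B\<close> and \<open>insert j B\<close> cancel in pairs.\<close>

lemma alternating_sum_Pow_cancels:
  fixes G :: "'a set \<Rightarrow> real"
  assumes "finite N" "j \<in> N" "\<And>B. B \<subseteq> N - {j} \<Longrightarrow> G (insert j B) = G B"
  shows "(\<Sum>B\<in>Pow N. (-1) ^ card B * G B) = 0"
proof -
  let ?N = "N - {j}"
  have N: "N = insert j ?N" using assms(2) by auto
  have "(\<Sum>B\<in>Pow N. (-1) ^ card B * G B) =
    (\<Sum>B\<in>Pow ?N. (-1) ^ card B * G B) + (\<Sum>B\<in>insert j ` Pow ?N. (-1) ^ card B * G B)"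
    by (subst N, subst Pow_insert, rule sum.union_disjoint) (use assms(1) in auto)
  also have "(\<Sum>B\<in>insert j ` Pow ?N. (-1) ^ card B * G B) =
      (\<Sum>B\<in>Pow ?N. (-1) ^ card (insert j B) * G (insert j B))"
    by (rule sum.reindex_cong[of "insert j"]) (auto simp: inj_on_def)
  also have "\<dots> = (\<Sum>B\<in>Pow ?N. - ((-1) ^ card B * G B))"
  proof (intro sum.cong refl)
    fix B assume "B \<in> Pow ?N"
    then have "finite B" "j \<notin> B" "G (insert j B) = G B"
      using assms(1,3) by (auto dest: finite_subset)
    then show "(-1) ^ card (insert j B) * G (insert j B) = - ((-1) ^ card B * G B)" by simp
  qed
  finally show ?thesis by (simp add: sum_negf)
qed

text \<open>If every such flip gave 0, then \<open>F\<close> would vanish on the whole subcube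
  through \<open>x\<close> in the directions \<open>N\<close>. The alternating sum of
  \<open>F\<close> over this subcube is, up to sign, the coefficient of \<open>N\<close>, which is
  nonzero.\<close>

lemma top_monomial_block:
  fixes a :: "'a set \<Rightarrow> real"
  assumes "finite A" "\<And>M. M \<in> A \<Longrightarrow> finite M \<and> card M \<le> card N" "N \<in> A" "a N \<noteq> 0"
    and F: "\<And>X. F X = (\<Sum>M\<in>A. a M * of_bool (M \<subseteq> X))"
  shows "\<exists>B\<subseteq>N. F (sym_diff x B) \<noteq> 0"
proof (rule ccontr)
  assume "\<not> ?thesis"
  then have zero: "F (sym_diff x B) = 0" if "B \<subseteq> N" for B using that by blast
  have N: "finite N" using assms by blast
  \<comment> \<open>Every point that agrees with \<open>x\<close> outside \<open>N\<close> is a flip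
    of \<open>x\<close> by a subset of \<open>N\<close>.\<close>
  have "F (x - N \<union> B) = 0" if "B \<in> Pow N" for B
  proof -
    have "x - N \<union> B = sym_diff x (sym_diff (x \<inter> N) B)" "sym_diff (x \<inter> N) B \<subseteq> N"
      using that by auto
    then show ?thesis using zero by metis
  qed
  then have "0 = (\<Sum>B\<in>Pow N. (-1) ^ card B * F (x - N \<union> B))" by simp
  also have "\<dots> = (\<Sum>M\<in>A. a M * (\<Sum>B\<in>Pow N. (-1) ^ card B * of_bool (M \<subseteq> x - N \<union> B)))"
    unfolding F sum_distrib_left by (subst sum.swap) (simp only: mult.left_commute)
  also have "\<dots> = (\<Sum>M\<in>A. if M = N then a N * (-1) ^ card N else 0)"
  proof (intro sum.cong refl)
    fix M assume M: "M \<in> A"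
    show "a M * (\<Sum>B\<in>Pow N. (-1) ^ card B * of_bool (M \<subseteq> x - N \<union> B)) =
      (if M = N then a N * (-1) ^ card N else 0)"
    proof (cases "M = N")
      case True
      have "(\<Sum>B\<in>Pow N. (-1) ^ card B * of_bool (N \<subseteq> x - N \<union> B) :: real) =
        (\<Sum>B\<in>{N}. (-1) ^ card B * of_bool (N \<subseteq> x - N \<union> B))"
        using N by (intro sum.mono_neutral_right) auto
      then show ?thesis using True by simp
    next
      case False
      \<comment> \<open>Since \<open>N\<close> has the largest size allowed, every other monomial
        misses some \<open>j\<close> in \<open>N\<close> and is cancelled by pairing along
        \<open>j\<close>.\<close>
      then have "\<not> N \<subseteq> M" using assms(2)[OF M] card_seteq[of M N] by auto
      then obtain j where j: "j \<in> N" "j \<notin> M" by blast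
      then have "(\<Sum>B\<in>Pow N. (-1) ^ card B * of_bool (M \<subseteq> x - N \<union> B) :: real) = 0"
        by (intro alternating_sum_Pow_cancels[OF N, of j]) auto
      then show ?thesis using False by simp
    qed
  qed
  also have "\<dots> = a N * (-1) ^ card N" using assms(1,3) by simp
  finally show False using assms(4) by simp
qed

text \<open>Only the finitely many coordinates in \<open>\<Union>A\<close> matter, so finitely many
  values occur even if the underlying type is infinite.\<close>

lemma deg_le_attains_max:
  assumes "deg_le d Q"
  obtains x where "\<And>X. \<bar>Q X\<bar> \<le> \<bar>Q x\<bar>"
proof -
  obtain A a where A: "finite A" "\<And>M. M \<in> A \<Longrightarrow> finite M \<and> card M \<le> d"
    "\<And>X. Q X = (\<Sum>M\<in>A. a M * of_bool (M \<subseteq> X))" using assms by (rule deg_leE) blast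
  have local: "Q X = Q (X \<inter> \<Union>A)" for X
    unfolding A(3) by (intro sum.cong refl arg_cong2[where f="(*)"] arg_cong[where f=of_bool]) auto
  have sub: "range (\<lambda>X. \<bar>Q X\<bar>) \<subseteq> (\<lambda>X. \<bar>Q X\<bar>) ` Pow (\<Union>A)"
  proof (rule image_subsetI)
    fix X
    show "\<bar>Q X\<bar> \<in> (\<lambda>X. \<bar>Q X\<bar>) ` Pow (\<Union>A)"
      by (rule image_eqI[of _ _ "X \<inter> \<Union>A"]) (subst local, auto)
  qed
  have "finite (Pow (\<Union>A))" using A(1,2) by auto
  then have fin: "finite (range (\<lambda>X. \<bar>Q X\<bar>))" using sub by (rule finite_surj)
  then have "Max (range (\<lambda>X. \<bar>Q X\<bar>)) \<in> range (\<lambda>X. \<bar>Q X\<bar>)" by (intro Max_in) auto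
  then obtain x where "Max (range (\<lambda>X. \<bar>Q X\<bar>)) = \<bar>Q x\<bar>" by blast
  then have "\<bar>Q X\<bar> \<le> \<bar>Q x\<bar>" for X using Max_ge[OF fin, of "\<bar>Q X\<bar>"] by simp
  then show thesis by (rule that)
qed

text \<open>Fix the variables of a maximal disjoint family of top monomials of \<open>P\<close>: this lowers the degree
  of \<open>P\<close>. The family is small since at a point where \<open>\<bar>Q\<bar>\<close> is maximal each of its members contains
  a block whose flip annihilates \<open>Q\<close>.\<close>
lemma card_sensitive_le:
  assumes "deg_le e P" "deg_le d Q" "\<And>X. P X = 0 \<longleftrightarrow> Q X \<noteq> 0" "e \<le> d"
  shows "finite {i. (P X = 0) \<noteq> (P (sym_diff X {i}) = 0)} \<and>
    card {i. (P X = 0) \<noteq> (P (sym_diff X {i}) = 0)} \<le> e * (d * (2 * 5 ^ d))"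
  using assms
proof (induction e arbitrary: P Q)
  case 0
  have "P (sym_diff X {i}) = P X" for i using 0(1) by (rule deg_le_0)
  then show ?case by (simp only:) simp
next
  case (Suc e)
  obtain x where x: "\<And>X. \<bar>Q X\<bar> \<le> \<bar>Q x\<bar>" using deg_le_attains_max Suc.prems(2) by blast
  show ?case
  proof (cases "Q x = 0")
    case True
    \<comment> \<open>If the maximum is 0, then \<open>Q\<close> is identically zero,
      \<open>P\<close> vanishes nowhere, and no coordinate is sensitive.\<close>
    then have "Q X = 0" for X using x[of X] by simp
    then have "P X \<noteq> 0" for X using Suc.prems(3) by simp
    then show ?thesis by simp
  next
    case False
    obtain A a where A: "finite A" "\<And>M. M \<in> A \<Longrightarrow> finite M \<and> card M \<le> Suc e"
      "\<And>M. M \<in> A \<Longrightarrow> a M \<noteq> 0"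
      "\<And>X. P X = (\<Sum>M\<in>A. a M * of_bool (M \<subseteq> X))" using Suc.prems(1) by (rule deg_leE) blast
    define T where "T = {M \<in> A. card M = Suc e}"
    let ?fam = "{D. D \<subseteq> T \<and> pairwise disjnt D}"
    have finT: "finite T" using A(1) by (simp add: T_def)
    have "finite ?fam" using finT by simp
    moreover have "?fam \<noteq> {}" by (auto intro: exI[of _ "{}"])
    ultimately obtain D where D: "D \<subseteq> T" "pairwise disjnt D"
      "\<And>D'. D' \<subseteq> T \<Longrightarrow> pairwise disjnt D' \<Longrightarrow> D \<subseteq> D' \<Longrightarrow> D = D'"
      using finite_has_maximal[of ?fam] by auto
    have finD: "finite D" using D(1) finT by (rule finite_subset)
    have "\<exists>B\<subseteq>M. P (sym_diff x B) \<noteq> 0" if "M \<in> D" for M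
      using that D(1) A by (intro top_monomial_block[of A M a]) (auto simp: T_def)
    then obtain \<beta> where \<beta>: "\<And>M. M \<in> D \<Longrightarrow> \<beta> M \<subseteq> M" "\<And>M. M \<in> D \<Longrightarrow> P (sym_diff x (\<beta> M)) \<noteq> 0"
      by metis
    \<comment> \<open>Here \<open>Q x\<close> is nonzero, so \<open>P x\<close> is 0, whereas
      flipping \<open>\<beta> M\<close> makes \<open>P\<close> nonzero. Nonempty disjoint blocks are
      distinct, so counting the blocks counts the members of \<open>D\<close>.\<close>
    have ne: "\<beta> M \<noteq> {}" if "M \<in> D" for M
      using \<beta>(2)[OF that] False Suc.prems(3)[of x] by auto
    have disj: "disjnt (\<beta> M) (\<beta> N)" if "M \<in> D" "N \<in> D" "M \<noteq> N" for M N
      using pairwiseD[OF D(2) that] \<beta>(1)[OF that(1)] \<beta>(1)[OF that(2)] by (auto simp: disjnt_iff)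
    have inj: "inj_on \<beta> D"
    proof (rule inj_onI, rule ccontr)
      fix M N assume "M \<in> D" "N \<in> D" "\<beta> M = \<beta> N" "M \<noteq> N"
      then show False using disj[of M N] ne[of N] by simp
    qed
    have "card (\<beta> ` D) \<le> 2 * 5 ^ d"
    proof (rule card_disjoint_blocks_le[OF Suc.prems(2) x False])
      show "finite (\<beta> ` D)" using finD by simp
      show "pairwise disjnt (\<beta> ` D)" unfolding pairwise_image using disj by (auto simp: pairwise_def)
      show "Q (sym_diff x B) = 0" if "B \<in> \<beta> ` D" for B using that \<beta>(2) Suc.prems(3) by auto
    qed
    then have cardD: "card D \<le> 2 * 5 ^ d" by (simp add: card_image inj)
    define S where "S = \<Union>D"
    have finS: "finite S" using finD D(1) A(2) unfolding S_def T_def by auto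
    have "card S \<le> (\<Sum>M\<in>D. card M)" unfolding S_def by (rule card_Union_le_sum_card)
    also have "\<dots> = card D * Suc e" using D(1) by (subst sum.cong[of D D _ "\<lambda>_. Suc e"]) (auto simp: T_def)
    also have "\<dots> \<le> 2 * 5 ^ d * d" using cardD Suc.prems(4) by (intro mult_mono) auto
    finally have cardS: "card S \<le> d * (2 * 5 ^ d)" by (simp add: mult_ac)
    \<comment> \<open>A top monomial avoiding \<open>S\<close> could be added to \<open>D\<close>,
      against maximality. Hence fixing the coordinates in \<open>S\<close> shortens every top
      monomial.\<close>
    have hit: "M \<inter> S \<noteq> {}" if "M \<in> T" for M
    proof
      assume M: "M \<inter> S = {}"
      then have "disjnt M N" if "N \<in> D" for N using that unfolding S_def disjnt_def by blast
      then have "pairwise disjnt (insert M D)" 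
        using D(2) by (auto simp: pairwise_insert disjnt_sym)
      then have "D = insert M D" using D(1) that by (intro D(3)) auto
      then have "M \<subseteq> S" unfolding S_def by blast
      then have "M = {}" using M by blast
      then show False using that by (simp add: T_def)
    qed
    \<comment> \<open>The coordinates in \<open>S\<close> are frozen at their values in the given
      point \<open>X\<close>, not in the maximum point \<open>x\<close>; \<open>S\<close> itself
      does not depend on \<open>X\<close>.\<close>
    define P' where "P' Z = P (Z - S \<union> X \<inter> S)" for Z
    define Q' where "Q' Z = Q (Z - S \<union> X \<inter> S)" for Z
    have "P' = (\<lambda>Z. \<Sum>M\<in>A. (a M * of_bool (M \<inter> S \<subseteq> X)) * of_bool (M - S \<subseteq> Z))"
      unfolding P'_def A(4) by (intro ext sum.cong refl) (auto split: split_of_bool)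
    moreover have "card (M - S) \<le> e" if "M \<in> A" for M
    proof (cases "card M = Suc e")
      case True
      then have "M \<in> T" using that by (simp add: T_def)
      then have "M - S \<subset> M" using hit by blast
      then show ?thesis using psubset_card_mono[of M "M - S"] A(2)[OF that] True by simp
    next
      case False
      then show ?thesis using A(2)[OF that] card_Diff_subset_Int[of M S] finS
        by (metis Diff_subset card_mono le_SucE le_trans)
    qed
    ultimately have degP': "deg_le e P'"
      using A(2) by (simp only:) (intro deg_le_sum deg_le_monomial; simp)
    have degQ': "deg_le d Q'" unfolding Q'_def using Suc.prems(2) by (rule deg_le_restrict)
    let ?I = "{i. (P X = 0) \<noteq> (P (sym_diff X {i}) = 0)}"
    let ?I' = "{i. (P' X = 0) \<noteq> (P' (sym_diff X {i}) = 0)}"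
    have IH: "finite ?I' \<and> card ?I' \<le> e * (d * (2 * 5 ^ d))"
      using Suc.prems(3,4) by (intro Suc.IH[OF degP' degQ']) (simp_all add: P'_def Q'_def)
    \<comment> \<open>Freezing \<open>S\<close> changes neither \<open>X\<close> nor its flips
      outside \<open>S\<close>, so each round adds at most \<open>card S\<close> sensitive
      coordinates.\<close>
    have "?I \<subseteq> S \<union> ?I'"
    proof (rule subsetI, rule UnCI)
      fix i assume i: "i \<in> ?I" "i \<notin> ?I'"
      show "i \<in> S"
      proof (rule ccontr)
        assume "i \<notin> S"
        then have "X - S \<union> X \<inter> S = X" "sym_diff X {i} - S \<union> X \<inter> S = sym_diff X {i}" by auto
        then have "P' X = P X" "P' (sym_diff X {i}) = P (sym_diff X {i})" by (simp_all only: P'_def)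
        with i show False by (simp only: mem_Collect_eq not_False_eq_True not_True_eq_False)
      qed
    qed
    moreover have "finite (S \<union> ?I')" using finS IH by simp
    moreover have "card (S \<union> ?I') \<le> Suc e * (d * (2 * 5 ^ d))"
      using card_Un_le[of S ?I'] cardS IH by simp
    ultimately show ?thesis by (meson card_mono finite_subset le_trans)
  qed
qed

section \<open>Support of functions of low degree\<close>

text \<open>In the discrete derivative along \<open>j\<close>, monomials without \<open>j\<close>
  cancel and those with \<open>j\<close> lose it.\<close>

lemma deg_le_derivative:
  assumes "deg_le d F" shows "deg_le (d - 1) (\<lambda>X. F (insert j X) - F (X - {j}))"
proof -
  obtain A a where A: "finite A" "\<And>M. M \<in> A \<Longrightarrow> finite M \<and> card M \<le> d"
    "\<And>X. F X = (\<Sum>M\<in>A. a M * of_bool (M \<subseteq> X))" using assms by (rule deg_leE) blast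
  have "(\<lambda>X. F (insert j X) - F (X - {j})) = (\<lambda>X. \<Sum>M\<in>A. of_bool (j \<in> M) * a M * of_bool (M - {j} \<subseteq> X))"
    unfolding A(3) sum_subtractf[symmetric]
    by (intro ext sum.cong refl) (auto split: split_of_bool)
  moreover have "deg_le (d - 1) (\<lambda>X. of_bool (j \<in> M) * a M * of_bool (M - {j} \<subseteq> X))" if "M \<in> A" for M
  proof (cases "j \<in> M")
    case True
    then show ?thesis using A(2)[OF that] by (intro deg_le_monomial) auto
  next
    case False
    then show ?thesis by (simp add: deg_le_const)
  qed
  ultimately show ?thesis by (simp only: deg_le_sum)
qed

text \<open>This is the Schwartz-Zippel bound on the cube, or the minimum distance of Reed-Muller
  codes. Split along \<open>j\<close>: if both halves are nonzero, each contributes its share by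
  induction. If one half vanishes, the other equals the derivative along \<open>j\<close> up to
  sign, whose lower degree makes up for the missing half.\<close>

lemma card_nonzero_ge:
  assumes "finite V" "deg_le d F" "X \<subseteq> V" "F X \<noteq> 0"
  shows "2 ^ card V \<le> 2 ^ d * card {X \<in> Pow V. F X \<noteq> 0}"
  using assms
proof (induction V arbitrary: F d X)
  case empty
  then have "{X \<in> Pow {}. F X \<noteq> 0} = {{}}" by auto
  then show ?case by simp
next
  case (insert j V)
  let ?N = "\<lambda>F. {X \<in> Pow V. F X \<noteq> 0}"
  let ?F1 = "\<lambda>X. F (insert j X)" and ?D = "\<lambda>X. F (insert j X) - F (X - {j})"
  have deg1: "deg_le d ?F1" using deg_le_restrict[OF insert.prems(1), of "{}" "{j}"] by simp
  have degD: "deg_le (d - 1) ?D" using deg_le_derivative[OF insert.prems(1)] .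
  have nj: "X - {j} = X" if "X \<in> Pow V" for X using that insert.hyps(2) by auto
  have split: "{X \<in> Pow (insert j V). F X \<noteq> 0} = ?N F \<union> insert j ` ?N ?F1"
    unfolding Pow_insert by auto
  have "?N F \<inter> insert j ` ?N ?F1 = {}" using insert.hyps(2) by auto
  moreover have "inj_on (insert j) (?N ?F1)" using insert.hyps(2) by (auto simp: inj_on_def)
  ultimately have card: "card {X \<in> Pow (insert j V). F X \<noteq> 0} = card (?N F) + card (?N ?F1)"
    unfolding split using insert.hyps(1) by (simp add: card_Un_disjoint card_image)
  \<comment> \<open>A nonzero derivative excludes constants, so the truncated subtraction
    \<open>d - 1\<close> is a genuine decrease.\<close>
  have pos: "d = Suc (d - 1)" if "?D Y \<noteq> 0" for Y
  proof (rule ccontr)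
    assume "d \<noteq> Suc (d - 1)"
    then have "d = 0" by simp
    then show False using that deg_le_0[of F "insert j Y" "Y - {j}"] insert.prems(1) by simp
  qed
  have "X \<in> ?N F \<union> insert j ` ?N ?F1" using insert.prems(2,3) unfolding split[symmetric] by simp
  then have "\<not> (?N F = {} \<and> ?N ?F1 = {})" by (metis (no_types, lifting) Un_empty empty_iff image_empty)
  then consider "?N F \<noteq> {}" "?N ?F1 \<noteq> {}" | "?N F \<noteq> {}" "?N ?F1 = {}" | "?N ?F1 \<noteq> {}" "?N F = {}"
    by argo
  then show ?case
  proof cases
    case 1
    then obtain Y Z where "Y \<in> ?N F" "Z \<in> ?N ?F1" by (meson all_not_in_conv)
    then have "2 ^ card V \<le> 2 ^ d * card (?N F)" "2 ^ card V \<le> 2 ^ d * card (?N ?F1)"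
      using insert.IH[OF insert.prems(1), of Y] insert.IH[OF deg1, of Z] by auto
    then show ?thesis unfolding card using insert.hyps by (simp add: distrib_left)
  next
    case 2
    then obtain Y where Y: "Y \<in> ?N F" by (meson all_not_in_conv)
    have "F (insert j Y) = 0" if "Y \<in> Pow V" for Y using 2(2) that by blast
    then have eq: "?N ?D = ?N F" by (simp add: nj cong: conj_cong)
    have D: "?D Y \<noteq> 0" using Y unfolding eq[symmetric] by (rule CollectE) blast
    have "2 ^ card V \<le> 2 ^ (d - 1) * card (?N ?D)"
      using D Y by (intro insert.IH[OF degD, of Y]) auto
    then have "2 ^ card V \<le> 2 ^ (d - 1) * card (?N F)" unfolding eq .
    moreover obtain d' where "d = Suc d'" using pos[OF D] by blast
    ultimately show ?thesis unfolding card using insert.hyps by (simp add: distrib_left)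
  next
    case 3
    then obtain Y where Y: "Y \<in> ?N ?F1" by (meson all_not_in_conv)
    have "F Y = 0" if "Y \<in> Pow V" for Y using 3(2) that by blast
    then have eq: "?N ?D = ?N ?F1" by (simp add: nj cong: conj_cong)
    have D: "?D Y \<noteq> 0" using Y unfolding eq[symmetric] by (rule CollectE) blast
    have "2 ^ card V \<le> 2 ^ (d - 1) * card (?N ?D)"
      using D Y by (intro insert.IH[OF degD, of Y]) auto
    then have "2 ^ card V \<le> 2 ^ (d - 1) * card (?N ?F1)" unfolding eq .
    moreover obtain d' where "d = Suc d'" using pos[OF D] by blast
    ultimately show ?thesis unfolding card using insert.hyps by (simp add: distrib_left)
  qed
qed

lemma deg_le_flip:
  assumes "deg_le d F" shows "deg_le d (\<lambda>X. F (sym_diff X {i}))"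
proof (rule deg_le_compose[OF assms])
  fix j
  have "j \<in> sym_diff X {i} \<longleftrightarrow> (if j = i then j \<notin> X else j \<in> X)" for X by auto
  then show "deg_le 1 (\<lambda>X. of_bool (j \<in> sym_diff X {i}))"
    by (cases "j = i") (simp_all only: if_True if_False refl deg_le_member deg_le_nonmember)
qed

section \<open>Double counting of sensitive pairs\<close>

text \<open>Count the pairs of a coordinate \<open>i\<close> and a point \<open>X\<close> at which
  \<open>i\<close> is sensitive. Each \<open>i\<close> occurs with at least a fraction
  \<open>1 / 4 ^ d\<close> of the points, and each point with at most \<open>?K\<close>
  coordinates.\<close>

lemma card_relevant_le:
  assumes V: "finite V" and P: "deg_le d P" and Q: "deg_le d Q"
    and PQ: "\<And>X. P X = 0 \<longleftrightarrow> Q X \<noteq> 0"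
    and rel: "\<And>i. i \<in> V \<Longrightarrow> \<exists>X\<subseteq>V. (P X = 0) \<noteq> (P (sym_diff X {i}) = 0)"
  shows "card V \<le> 4 ^ d * (d * (d * (2 * 5 ^ d)))"
proof -
  define R where "R i X \<longleftrightarrow> (P X = 0) \<noteq> (P (sym_diff X {i}) = 0)" for i X
  let ?K = "d * (d * (2 * 5 ^ d))"
  have infl: "2 ^ card V \<le> 4 ^ d * card {X \<in> Pow V. R i X}" if i: "i \<in> V" for i
  proof -
    \<comment> \<open>The support of \<open>G\<close> consists of the points where flipping
      \<open>i\<close> turns \<open>P\<close> from nonzero to zero. A sensitive edge in direction
      \<open>i\<close> has such an endpoint, so \<open>G\<close> is not identically zero on the
      cube.\<close>
    define G where "G X = P X * Q (sym_diff X {i})" for X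
    have G: "G X \<noteq> 0 \<longleftrightarrow> P X \<noteq> 0 \<and> P (sym_diff X {i}) = 0" for X
      unfolding G_def using PQ[of "sym_diff X {i}"] by simp
    have degG: "deg_le (d + d) G" unfolding G_def by (intro deg_le_mult deg_le_flip P Q)
    obtain X where X: "X \<subseteq> V" "(P X = 0) \<noteq> (P (sym_diff X {i}) = 0)" using rel[OF i] by blast
    have flip2: "sym_diff (sym_diff X {i}) {i} = X" by auto
    have "G X \<noteq> 0 \<or> G (sym_diff X {i}) \<noteq> 0" unfolding G flip2 using X(2) by blast
    moreover have "sym_diff X {i} \<subseteq> V" using X(1) i by auto
    ultimately have "2 ^ card V \<le> 2 ^ (d + d) * card {X \<in> Pow V. G X \<noteq> 0}"
      using card_nonzero_ge[OF V degG] X(1) by blast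
    also have "card {X \<in> Pow V. G X \<noteq> 0} \<le> card {X \<in> Pow V. R i X}"
    proof (rule card_mono)
      show "finite {X \<in> Pow V. R i X}" using V by simp
      show "{X \<in> Pow V. G X \<noteq> 0} \<subseteq> {X \<in> Pow V. R i X}"
        unfolding G R_def by blast
    qed
    finally show ?thesis by (simp add: power_add power_mult_distrib[symmetric])
  qed
  have sens: "card {i \<in> V. R i X} \<le> ?K" for X
  proof -
    have fin: "finite {i. R i X}" and le: "card {i. R i X} \<le> ?K"
      using card_sensitive_le[OF P Q PQ order_refl] unfolding R_def by blast+
    have "card {i \<in> V. R i X} \<le> card {i. R i X}" using fin by (rule card_mono) blast
    then show ?thesis using le by linarith
  qed
  have "card V * 2 ^ card V = (\<Sum>i\<in>V. 2 ^ card V)" by simp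
  also have "\<dots> \<le> (\<Sum>i\<in>V. 4 ^ d * card {X \<in> Pow V. R i X})" by (rule sum_mono[OF infl])
  also have "\<dots> = 4 ^ d * (\<Sum>i\<in>V. \<Sum>X\<in>Pow V. of_bool (R i X))"
    using V by (simp add: sum_distrib_left Int_def)
  also have "(\<Sum>i\<in>V. \<Sum>X\<in>Pow V. of_bool (R i X)) = (\<Sum>X\<in>Pow V. \<Sum>i\<in>V. of_bool (R i X))"
    by (rule sum.swap)
  also have "(\<Sum>X\<in>Pow V. \<Sum>i\<in>V. of_bool (R i X)) = (\<Sum>X\<in>Pow V. card {i \<in> V. R i X})"
    using V by (simp add: Int_def)
  also have "\<dots> \<le> (\<Sum>X\<in>Pow V. ?K)" by (rule sum_mono[OF sens])
  also have "\<dots> = ?K * 2 ^ card V" using V by (simp add: card_Pow)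
  finally have "card V * 2 ^ card V \<le> (4 ^ d * ?K) * 2 ^ card V" by (simp add: mult_ac)
  then show ?thesis by (simp only: mult_le_cancel2) simp
qed

section \<open>Rational representations\<close>

text \<open>Restricting to \<open>{1..n}\<close> yields a point of the cube for every set
  \<open>X\<close>, so facts about representations carry over to all sets and not only to subsets of
  \<open>{1..n}\<close>.\<close>

definition cube_point :: "nat \<Rightarrow> nat set \<Rightarrow> nat \<Rightarrow> real" where
  "cube_point n X = restrict (\<lambda>i. of_bool (i \<in> X)) {1..n}"

lemma cube_point_in_cube: "cube_point n X \<in> cube n"
  by (auto simp: cube_point_def cube_def)

lemma cube_eq_cube_point:
  assumes "x \<in> cube n" obtains X where "X \<subseteq> {1..n}" "x = cube_point n X"
proof
  show "{i \<in> {1..n}. x i = 1} \<subseteq> {1..n}" by blast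
  have "x i \<in> {0, 1}" if "i \<in> {1..n}" for i using assms that by (auto simp: cube_def)
  then have "x i = of_bool (x i = 1)" if "i \<in> {1..n}" for i using that by fastforce
  moreover have "x i = undefined" if "i \<notin> {1..n}" for i
    using assms that unfolding cube_def by (rule PiE_arb)
  ultimately show "x = cube_point n {i \<in> {1..n}. x i = 1}"
    unfolding cube_point_def restrict_def by (intro ext) auto
qed

lemma flip_cube_point: "i \<in> {1..n} \<Longrightarrow> flip i (cube_point n X) = cube_point n (sym_diff X {i})"
  by (rule ext) (auto simp: flip_def cube_point_def restrict_def)

lemma prod_cube_point:
  assumes "M \<subseteq> {1..n}" shows "(\<Prod>i\<in>M. cube_point n X i) = of_bool (M \<subseteq> X)"
proof -
  have "finite M" using assms by (rule finite_subset) simp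
  then show ?thesis using assms by (induction M) (auto simp: cube_point_def)
qed

lemma mpoly_eval_multilinear:
  assumes "multilinear p"
  shows "mpoly_eval p x =
    (\<Sum>m\<in>Poly_Mapping.keys p. Poly_Mapping.lookup p m * (\<Prod>i\<in>Poly_Mapping.keys m. x i))"
  unfolding mpoly_eval_def
proof (intro sum.cong refl arg_cong2[where f="(*)"] prod.cong)
  fix m i assume m: "m \<in> Poly_Mapping.keys p" "i \<in> Poly_Mapping.keys m"
  then have "Poly_Mapping.lookup m i \<le> 1" "Poly_Mapping.lookup m i \<noteq> 0"
    using assms by (auto simp: multilinear_def in_keys_iff)
  then have "Poly_Mapping.lookup m i = 1" by linarith
  then show "x i ^ Poly_Mapping.lookup m i = x i" by simp
qed

lemma card_keys_le_mpoly_degree: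
  assumes "m \<in> Poly_Mapping.keys p"
  shows "card (Poly_Mapping.keys m) \<le> mpoly_degree p"
proof -
  have "card (Poly_Mapping.keys m) = (\<Sum>i\<in>Poly_Mapping.keys m. 1)" by simp
  also have "\<dots> \<le> (\<Sum>i\<in>Poly_Mapping.keys m. Poly_Mapping.lookup m i)"
    by (rule sum_mono) (simp add: in_keys_iff Suc_leI)
  also have "\<dots> \<le> mpoly_degree p"
    unfolding mpoly_degree_def using assms by (intro Max_ge) auto
  finally show ?thesis .
qed

lemma deg_le_mpoly_eval:
  assumes "in_vars n p" "multilinear p"
  shows "deg_le (mpoly_degree p) (\<lambda>X. mpoly_eval p (cube_point n X))"
proof -
  have "mpoly_eval p (cube_point n X) =
    (\<Sum>m\<in>Poly_Mapping.keys p. Poly_Mapping.lookup p m * of_bool (Poly_Mapping.keys m \<subseteq> X))" for X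
    unfolding mpoly_eval_multilinear[OF assms(2)] using assms(1)
    by (intro sum.cong refl arg_cong2[where f="(*)"] prod_cube_point) (auto simp: in_vars_def)
  then show ?thesis
    by (simp only:) (intro deg_le_sum deg_le_monomial finite_keys card_keys_le_mpoly_degree)
qed

section \<open>Multilinear interpolation and existence of representations\<close>

text \<open>By induction, monomials without \<open>j\<close> interpolate \<open>F\<close> where
  \<open>j\<close> is absent, and those with \<open>j\<close> interpolate the increment of
  \<open>F\<close> along \<open>j\<close>.\<close>

lemma subset_expansion:
  fixes F :: "'a set \<Rightarrow> real"
  assumes "finite V"
  shows "\<exists>a. \<forall>X\<subseteq>V. F X = (\<Sum>M\<in>Pow V. a M * of_bool (M \<subseteq> X))"
  using assms
proof (induction V arbitrary: F)
  case empty
  show ?case by (rule exI[of _ F]) simp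
next
  case (insert j V)
  obtain a where a: "\<And>X. X \<subseteq> V \<Longrightarrow> F X = (\<Sum>M\<in>Pow V. a M * of_bool (M \<subseteq> X))"
    using insert.IH by blast
  obtain b where b: "\<And>X. X \<subseteq> V \<Longrightarrow> F (insert j X) - F X = (\<Sum>M\<in>Pow V. b M * of_bool (M \<subseteq> X))"
    using insert.IH[of "\<lambda>X. F (insert j X) - F X"] by blast
  define c where "c M = (if j \<in> M then b (M - {j}) else a M)" for M
  have "F X = (\<Sum>M\<in>Pow (insert j V). c M * of_bool (M \<subseteq> X))" if X: "X \<subseteq> insert j V" for X
  proof -
    let ?X = "X - {j}"
    have sub: "?X \<subseteq> V" using X by auto
    have nj: "j \<notin> M" if "M \<in> Pow V" for M using that insert.hyps by auto
    have "(\<Sum>M\<in>Pow (insert j V). c M * of_bool (M \<subseteq> X)) =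
      (\<Sum>M\<in>Pow V. c M * of_bool (M \<subseteq> X)) + (\<Sum>M\<in>insert j ` Pow V. c M * of_bool (M \<subseteq> X))"
      unfolding Pow_insert by (rule sum.union_disjoint) (use insert.hyps in auto)
    also have "(\<Sum>M\<in>Pow V. c M * of_bool (M \<subseteq> X)) = (\<Sum>M\<in>Pow V. a M * of_bool (M \<subseteq> ?X))"
      using nj by (intro sum.cong refl) (auto simp: c_def split: split_of_bool)
    also have "\<dots> = F ?X" using a[OF sub] ..
    also have "(\<Sum>M\<in>insert j ` Pow V. c M * of_bool (M \<subseteq> X)) =
        (\<Sum>M\<in>Pow V. c (insert j M) * of_bool (insert j M \<subseteq> X))"
      using insert.hyps(2) by (intro sum.reindex_cong[of "insert j"]) (auto simp: inj_on_def)
    also have "\<dots> = (\<Sum>M\<in>Pow V. of_bool (j \<in> X) * (b M * of_bool (M \<subseteq> ?X)))"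
      using nj by (intro sum.cong refl) (auto simp: c_def split: split_of_bool)
    also have "\<dots> = of_bool (j \<in> X) * (F (insert j ?X) - F ?X)"
      unfolding b[OF sub] sum_distrib_left ..
    finally show ?thesis by (cases "j \<in> X") (simp_all add: insert_absorb)
  qed
  then show ?case by blast
qed

lemma ex_multilinear_mpoly:
  "\<exists>p. in_vars n p \<and> multilinear p \<and>
     (\<forall>x. mpoly_eval p x = (\<Sum>M\<in>Pow {1..n}. a M * (\<Prod>i\<in>M. x i)))"
proof -
  let ?V = "{1..n}"
  define mon :: "nat set \<Rightarrow> nat \<Rightarrow>\<^sub>0 nat" where
    "mon M = Abs_poly_mapping (\<lambda>i. of_bool (i \<in> M))" for M
  have mon: "Poly_Mapping.lookup (mon M) = (\<lambda>i. of_bool (i \<in> M))" if "M \<in> Pow ?V" for M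
    unfolding mon_def
    by (rule lookup_Abs_poly_mapping) (use that in \<open>auto intro: finite_subset\<close>)
  have keys: "Poly_Mapping.keys (mon M) = M" if "M \<in> Pow ?V" for M
    using mon[OF that] by (auto simp: in_keys_iff)
  define p :: real_mpoly where
    "p = Abs_poly_mapping (\<lambda>m. if m \<in> mon ` Pow ?V then a (Poly_Mapping.keys m) else 0)"
  have p: "Poly_Mapping.lookup p = (\<lambda>m. if m \<in> mon ` Pow ?V then a (Poly_Mapping.keys m) else 0)"
    unfolding p_def
  proof (rule lookup_Abs_poly_mapping)
    show "finite {m. (if m \<in> mon ` Pow ?V then a (Poly_Mapping.keys m) else 0) \<noteq> 0}"
      by (rule finite_subset[of _ "mon ` Pow ?V"]) auto
  qed
  have keysp: "Poly_Mapping.keys p \<subseteq> mon ` Pow ?V" by (auto simp: in_keys_iff p split: if_splits)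
  have ex: "\<exists>M\<in>Pow ?V. m = mon M" if "m \<in> Poly_Mapping.keys p" for m using keysp that by blast
  have "in_vars n p"
    unfolding in_vars_def
  proof
    fix m assume "m \<in> Poly_Mapping.keys p"
    then obtain M where "M \<in> Pow ?V" "m = mon M" using ex by blast
    then show "Poly_Mapping.keys m \<subseteq> ?V" using keys[of M] by simp
  qed
  moreover have ml: "multilinear p"
    unfolding multilinear_def
  proof (intro ballI allI)
    fix m i assume "m \<in> Poly_Mapping.keys p"
    then obtain M where "M \<in> Pow ?V" "m = mon M" using ex by blast
    then show "Poly_Mapping.lookup m i \<le> 1" using mon[of M] by simp
  qed
  moreover have "mpoly_eval p x = (\<Sum>M\<in>Pow ?V. a M * (\<Prod>i\<in>M. x i))" for x
  proof -
    have inj: "inj_on mon (Pow ?V)" by (rule inj_onI) (metis keys)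
    have "mpoly_eval p x = (\<Sum>m\<in>mon ` Pow ?V. Poly_Mapping.lookup p m * (\<Prod>i\<in>Poly_Mapping.keys m. x i))"
      unfolding mpoly_eval_multilinear[OF ml] using keysp
      by (intro sum.mono_neutral_left) (auto simp: in_keys_iff)
    also have "\<dots> = (\<Sum>M\<in>Pow ?V. Poly_Mapping.lookup p (mon M) * (\<Prod>i\<in>Poly_Mapping.keys (mon M). x i))"
      by (simp only: sum.reindex[OF inj] comp_def)
    also have "\<dots> = (\<Sum>M\<in>Pow ?V. a M * (\<Prod>i\<in>M. x i))"
      by (intro sum.cong refl) (simp add: p keys)
    finally show ?thesis .
  qed
  ultimately show ?thesis by blast
qed

text \<open>Interpolate \<open>f\<close> for the numerator and the constant 1 for the denominator.
  Thus the infimum defining \<open>rdeg\<close> is over a nonempty set and is attained.\<close>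

lemma ex_rational_representation: "\<exists>p q. rational_representation n f p q"
proof -
  have interp: "\<exists>p. in_vars n p \<and> multilinear p \<and> (\<forall>x\<in>cube n. mpoly_eval p x = g x)"
    for g :: "(nat \<Rightarrow> real) \<Rightarrow> real"
  proof -
    obtain a where a: "\<And>X. X \<subseteq> {1..n} \<Longrightarrow>
        g (cube_point n X) = (\<Sum>M\<in>Pow {1..n}. a M * of_bool (M \<subseteq> X))"
      using subset_expansion[of "{1..n}" "\<lambda>X. g (cube_point n X)"] by auto
    obtain p where p: "in_vars n p" "multilinear p"
      "\<And>x. mpoly_eval p x = (\<Sum>M\<in>Pow {1..n}. a M * (\<Prod>i\<in>M. x i))"
      using ex_multilinear_mpoly by blast
    have "mpoly_eval p x = g x" if x: "x \<in> cube n" for x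
    proof -
      obtain X where X: "X \<subseteq> {1..n}" "x = cube_point n X" using cube_eq_cube_point[OF x] by blast
      show ?thesis unfolding X(2) a[OF X(1)] p(3)
        by (intro sum.cong refl arg_cong2[where f="(*)"] prod_cube_point) auto
    qed
    with p show ?thesis by blast
  qed
  obtain p q where "in_vars n p" "multilinear p" "\<forall>x\<in>cube n. mpoly_eval p x = f x"
    "in_vars n q" "multilinear q" "\<forall>x\<in>cube n. mpoly_eval q x = 1"
    using interp[of f] interp[of "\<lambda>_. 1"] by blast
  then have "rational_representation n f p q" by (simp add: rational_representation_def)
  then show ?thesis by blast
qed

section \<open>The logarithmic lower bound\<close>

lemma rational_representation_card_le:
  assumes rep: "rational_representation n f p q" and f: "f \<in> cube n \<rightarrow> {0, 1}"
    and dep: "\<And>i. i \<in> {1..n} \<Longrightarrow> depends_on n f i"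
    and d: "mpoly_degree p \<le> d" "mpoly_degree q \<le> d"
  shows "n \<le> 4 ^ d * (d * (d * (2 * 5 ^ d)))"
proof -
  let ?P = "\<lambda>X. mpoly_eval p (cube_point n X)" and ?q = "\<lambda>X. mpoly_eval q (cube_point n X)"
  let ?Q = "\<lambda>X. ?P X - ?q X"
  have P: "deg_le d ?P" and q: "deg_le d ?q"
    using rep d by (auto simp: rational_representation_def intro: deg_le_mono[OF deg_le_mpoly_eval])
  have quot: "?q X \<noteq> 0" "f (cube_point n X) = ?P X / ?q X" "f (cube_point n X) \<in> {0, 1}" for X
    using rep f cube_point_in_cube[of n X] by (auto simp: rational_representation_def)
  have f0: "f (cube_point n X) = 0 \<longleftrightarrow> ?P X = 0" for X using quot(1,2)[of X] by simp
  have f1: "f (cube_point n X) = 1 \<longleftrightarrow> ?Q X = 0" for X using quot(1,2)[of X] by auto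
  \<comment> \<open>The zeros of \<open>?P\<close> are where \<open>f\<close> is 0 and those of
    \<open>?Q\<close> where \<open>f\<close> is 1; as \<open>f\<close> takes only these values,
    exactly one of them vanishes.\<close>
  have PQ: "?P X = 0 \<longleftrightarrow> ?Q X \<noteq> 0" for X
    unfolding f0[symmetric] f1[symmetric] using quot(3)[of X] by auto
  have "\<exists>X\<subseteq>{1..n}. (?P X = 0) \<noteq> (?P (sym_diff X {i}) = 0)" if i: "i \<in> {1..n}" for i
  proof -
    obtain x where x: "x \<in> cube n" "f x \<noteq> f (flip i x)" using dep[OF i] by (auto simp: depends_on_def)
    obtain X where X: "X \<subseteq> {1..n}" "x = cube_point n X" using cube_eq_cube_point[OF x(1)] by blast
    have "f (cube_point n X) \<noteq> f (cube_point n (sym_diff X {i}))"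
      using x(2) unfolding X(2) flip_cube_point[OF i] .
    then have "(f (cube_point n X) = 0) \<noteq> (f (cube_point n (sym_diff X {i})) = 0)"
      using quot(3)[of X] quot(3)[of "sym_diff X {i}"] by auto
    then show ?thesis unfolding f0 using X(1) by blast
  qed
  then have "card {1..n} \<le> 4 ^ d * (d * (d * (2 * 5 ^ d)))"
    by (intro card_relevant_le[OF _ P deg_le_diff[OF P q] PQ]) auto
  then show ?thesis by simp
qed

theorem theorem4p5:
  "\<exists>c::real. c > 0 \<and>
     (\<forall>n::nat. n \<ge> 2 \<longrightarrow>
       (\<forall>f :: (nat \<Rightarrow> real) \<Rightarrow> real.
          f \<in> cube n \<rightarrow> {0, 1} \<longrightarrow> (\<forall>i\<in>{1..n}. depends_on n f i) \<longrightarrow>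
          real (rdeg n f) \<ge> c * ln (real n)))"
proof (intro exI[of _ "1 / ln (160::real)"] conjI allI impI)
  show "1 / ln (160::real) > 0" by simp
  fix n :: nat and f :: "(nat \<Rightarrow> real) \<Rightarrow> real"
  assume n: "n \<ge> 2" and f: "f \<in> cube n \<rightarrow> {0, 1}" and dep: "\<forall>i\<in>{1..n}. depends_on n f i"
  let ?S = "{max (mpoly_degree p) (mpoly_degree q) | p q. rational_representation n f p q}"
  have "?S \<noteq> {}" using ex_rational_representation[of n f] by blast
  then have "rdeg n f \<in> ?S" unfolding rdeg_def by (rule Inf_nat_def1)
  then obtain p q where pq: "rational_representation n f p q"
    "rdeg n f = max (mpoly_degree p) (mpoly_degree q)" by blast
  define d where "d = rdeg n f"
  have "n \<le> 4 ^ d * (d * (d * (2 * 5 ^ d)))"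
    using dep pq(2) by (intro rational_representation_card_le[OF pq(1) f]) (auto simp: d_def)
  \<comment> \<open>Both factors \<open>d\<close> and the factor 2 are absorbed into powers of 2,
    giving the base 160 = 4 * 2 * 2 * 2 * 5. For \<open>d = 0\<close> the left side is 0.\<close>
  also have "\<dots> \<le> 4 ^ d * (2 ^ d * (2 ^ d * (2 ^ d * 5 ^ d)))"
  proof (cases "d = 0")
    case False
    then have "2 \<le> (2::nat) ^ d" using self_le_power[of "2::nat" d] by simp
    then show ?thesis using less_exp[of d] by (intro mult_mono) auto
  qed simp
  also have "\<dots> = 160 ^ d" by (simp add: power_mult_distrib[symmetric])
  finally have "ln (real n) \<le> ln (160 ^ d)" using n by (subst ln_le_cancel_iff) (auto simp flip: of_nat_le_iff)
  also have "\<dots> = real d * ln 160" by (simp add: ln_realpow)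
  finally show "real (rdeg n f) \<ge> 1 / ln 160 * ln (real n)" by (simp add: d_def field_simps)
qed

end
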